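(* Let $\alpha\ge 0$, $a_1>0$ and $c>0$ be arbitrary constants, and let $a_n=a_1+(n-1)\alpha$ for $n\ge 1$. Suppose that $G_n\sim\mathrm{gamma}(c,1)$ and $U_n\sim\mathrm{beta}(a_n,c+\alpha)$, $n\ge 1$, are all independent random variables, and let $\Pi_j=\prod_{l=1}^{j-1}U_l$ for $j\ge 1$ (so $\Pi_1=1$). Then the random series $\sum_{j=1}^\infty G_j\Pi_j$ converges almost surely, and the sequence $$\tilde V_n=\frac{G_n\Pi_n}{\sum_{j=1}^\infty G_j\Pi_j},\qquad n\ge 1,$$ has the stick-breaking representation $$\tilde V_1=\tilde Y_1,\qquad \tilde V_n=(1-\tilde Y_1)\cdots(1-\tilde Y_{n-1})\tilde Y_n,\quad n\ge 2,$$ with independent random variables $\tilde Y_n\sim\mathrm{beta}(c,a_n)$, $n\ge1$.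
   Context: $\mathrm{gamma}(c,1)$ denotes the gamma distribution with density proportional to $x^{c-1}e^{-x}$ on $(0,\infty)$. $\mathrm{beta}(a,b)$ denotes the distribution with density proportional to $x^{a-1}(1-x)^{b-1}$ on $(0,1)$. *)

theory Defs
  imports "HOL-Probability.Probability"
begin

text \<open>
  The normalising constants are the library's Euler integrals: \<open>Gamma c\<close> is the integral of
  \<open>x powr (c - 1) * exp (- x)\<close> over \<open>x > 0\<close>, and \<open>Beta a b\<close> is the integral of
  \<open>x powr (a - 1) * (1 - x) powr (b - 1)\<close> over \<open>0 < x < 1\<close>. These are probability densities on
  the real line for \<open>c > 0\<close> and for \<open>a > 0\<close>, \<open>b > 0\<close>, respectively.
\<close>

definition gamma_density :: "real \<Rightarrow> real \<Rightarrow> real" where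
  "gamma_density c x = (if 0 < x then x powr (c - 1) * exp (- x) / Gamma c else 0)"

definition beta_density :: "real \<Rightarrow> real \<Rightarrow> real \<Rightarrow> real" where
  "beta_density a b x =
     (if 0 < x \<and> x < 1 then x powr (a - 1) * (1 - x) powr (b - 1) / Beta a b else 0)"

end

theory Submission
  imports Defs
begin

text \<open>
  Write \<open>R n = (\<Sum>j. G (n + j) * U n * \<dots> * U (n + j - 1))\<close> for the series started at index \<open>n\<close>, so that
  \<open>R n = G n + U n * R (n + 1)\<close>, and put \<open>Y n = G n / R n\<close>. Then \<open>1 - Y n = U n * R (n + 1) / R n\<close>, and the
  stick-breaking formula for \<open>V n\<close> is a telescoping product. What has to be shown is that the
  series converges and that the \<open>Y n\<close> are independent with law beta(c, a n).

  Both follow from the beta-gamma algebra (lemma \<open>gamma_beta_renewal\<close>): if \<open>g\<close>, \<open>u\<close>, \<open>r\<close> are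
  independent with laws gamma(c), beta(a n, c + \<alpha>) and gamma(c + a (n + 1)), then, because
  \<open>c + a (n + 1) = a n + (c + \<alpha>)\<close>, the product \<open>u * r\<close> is gamma(a n), and hence \<open>g + u * r\<close> and
  \<open>g / (g + u * r)\<close> are independent with laws gamma(c + a n) and beta(c, a n).

  The law of \<open>R n\<close> is found by truncation. If the tail \<open>R (n + m)\<close> is replaced by an independent
  gamma(c + a (n + m)) variable, then \<open>m\<close> renewal steps show that the resulting sum is
  gamma(c + a n) exactly (\<open>closed_partial_sum_law\<close>). Taking means bounds the expected partial
  sums by \<open>c + a n\<close>, which gives almost sure convergence. The mean of the substituted remainder is
  \<open>a n / (a (n + 1) + c) * \<dots> * a (n + m - 1) / (a (n + m) + c)\<close> times \<open>a (n + m) + c\<close>;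
  it tends to 0 because \<open>a l\<close> grows at most linearly, so that
  \<open>\<Sum> 1 / a l\<close> diverges. Comparing characteristic functions, \<open>R n\<close> is gamma(c + a n)
  (\<open>tail_law\<close>). With this law as the base case, induction on \<open>m\<close> with one renewal step at the
  front shows that \<open>R n, Y n, \<dots>, Y (n + m - 1)\<close> are independent (\<open>tail_sticks_joint_law\<close>).
\<close>

section \<open>Gamma and beta laws\<close>

text \<open>
  The gamma(c, 1) and beta(a, b) distributions, as measures on the Borel sets of the whole line that
  are concentrated on \<open>{0<..}\<close> and \<open>{0<..<1}\<close>. They are probability measures for positive
  parameters.
\<close>

definition gamma_law :: "real \<Rightarrow> real measure" where
  "gamma_law c = density lborel (\<lambda>x. ennreal (gamma_density c x))"

definition beta_law :: "real \<Rightarrow> real \<Rightarrow> real measure" where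
  "beta_law a b = density lborel (\<lambda>x. ennreal (beta_density a b x))"

lemma gamma_density_measurable [measurable]: "gamma_density c \<in> borel_measurable borel"
  unfolding gamma_density_def[abs_def] by measurable

lemma beta_density_measurable [measurable]: "beta_density a b \<in> borel_measurable borel"
  unfolding beta_density_def[abs_def] by measurable

lemma sets_gamma_law [simp, measurable_cong]: "sets (gamma_law c) = sets borel"
  by (simp add: gamma_law_def)

lemma sets_beta_law [simp, measurable_cong]: "sets (beta_law a b) = sets borel"
  by (simp add: beta_law_def)

lemma space_gamma_law [simp]: "space (gamma_law c) = UNIV"
  by (simp add: gamma_law_def)

lemma space_beta_law [simp]: "space (beta_law a b) = UNIV"
  by (simp add: beta_law_def)

lemma gamma_density_nonneg: "c > 0 \<Longrightarrow> 0 \<le> gamma_density c x"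
  by (simp add: gamma_density_def Gamma_real_pos less_imp_le)

lemma nn_integral_gamma_law:
  "f \<in> borel_measurable borel \<Longrightarrow>
    (\<integral>\<^sup>+x. f x \<partial>gamma_law c) = (\<integral>\<^sup>+x. ennreal (gamma_density c x) * f x \<partial>lborel)"
  unfolding gamma_law_def by (rule nn_integral_density) auto

lemma nn_integral_beta_law:
  "f \<in> borel_measurable borel \<Longrightarrow>
    (\<integral>\<^sup>+x. f x \<partial>beta_law a b) = (\<integral>\<^sup>+x. ennreal (beta_density a b x) * f x \<partial>lborel)"
  unfolding beta_law_def by (rule nn_integral_density) auto

lemma AE_gamma_law_pos: "AE x in gamma_law c. x > 0"
  unfolding gamma_law_def by (subst AE_density) (auto simp: gamma_density_def)

lemma AE_beta_law_pos: "AE x in beta_law a b. x > 0"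
  unfolding beta_law_def by (subst AE_density) (auto simp: beta_density_def)

lemma prob_space_gamma_law:
  assumes "c > 0"
  shows "prob_space (gamma_law c)"
proof
  have G: "Gamma c > 0" using assms by (rule Gamma_real_pos)
  have "emeasure (gamma_law c) (space (gamma_law c)) = (\<integral>\<^sup>+x. ennreal (gamma_density c x) \<partial>lborel)"
    by (simp add: gamma_law_def emeasure_density)
  also have "\<dots> = (\<integral>\<^sup>+x. ennreal (1 / Gamma c) *
      ennreal (indicator {0..} x * x powr (c - 1) / exp x) \<partial>lborel)"
    using G by (intro nn_integral_cong_AE AE_I[of _ _ "{0}"])
      (auto simp: gamma_density_def exp_minus field_simps simp flip: ennreal_mult split: split_indicator)
  also have "\<dots> = ennreal (1 / Gamma c) * ennreal (Gamma c)"
    by (subst nn_integral_cmult) (auto simp: Gamma_conv_nn_integral_real[OF assms])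
  also have "\<dots> = 1"
    using G by (simp flip: ennreal_mult)
  finally show "emeasure (gamma_law c) (space (gamma_law c)) = 1" .
qed

lemma gamma_density_times_self:
  assumes "c > 0"
  shows "gamma_density c x * x = c * gamma_density (c + 1) x"
proof -
  have "Gamma (c + 1) = c * Gamma c"
    using assms by (intro Gamma_plus1) (auto simp: nonpos_Ints_def)
  then show ?thesis
    using assms Gamma_real_pos[of c] by (auto simp: gamma_density_def powr_diff)
qed

lemma gamma_law_mean:
  assumes "c > 0"
  shows "(\<integral>\<^sup>+x. ennreal x \<partial>gamma_law c) = ennreal c"
proof -
  interpret P: prob_space "gamma_law (c + 1)"
    using assms by (intro prob_space_gamma_law) simp
  have "ennreal (gamma_density c x) * ennreal x = ennreal c * ennreal (gamma_density (c + 1) x)" for x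
  proof (cases "x > 0")
    case True
    then show ?thesis
      using assms gamma_density_times_self[OF assms, of x]
      by (simp add: gamma_density_nonneg flip: ennreal_mult)
  qed (simp add: gamma_density_def)
  then have "(\<integral>\<^sup>+x. ennreal x \<partial>gamma_law c) =
      ennreal c * (\<integral>\<^sup>+x. ennreal (gamma_density (c + 1) x) \<partial>lborel)"
    by (simp add: nn_integral_gamma_law nn_integral_cmult)
  also have "(\<integral>\<^sup>+x. ennreal (gamma_density (c + 1) x) \<partial>lborel) = 1"
    using P.emeasure_space_1 by (simp add: gamma_law_def emeasure_density)
  finally show ?thesis by simp
qed

section \<open>The beta-gamma algebra\<close>

text \<open>
  The change of variables \<open>(g, v) = (x * y, x * (1 - y))\<close>, whose Jacobian is \<open>x\<close>, splits the product
  of two gamma densities into a gamma density in \<open>x = g + v\<close> and a beta density in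
  \<open>y = g / (g + v)\<close>.
\<close>

lemma gamma_densities_product:
  assumes "a > 0" "b > 0" "x > 0"
  shows "x * (gamma_density a (x * y) * gamma_density b (x - x * y))
    = gamma_density (a + b) x * beta_density a b y"
proof (cases "0 < y \<and> y < 1")
  case True
  have x1: "x - x * y = x * (1 - y)" by (simp add: algebra_simps)
  have pos: "0 < x * y" "0 < x * (1 - y)" using True assms by auto
  have G: "Gamma a > 0" "Gamma b > 0" "Gamma (a + b) > 0"
    using assms by (auto intro!: Gamma_real_pos)
  have "x * ((x * y) powr (a - 1) * (x * (1 - y)) powr (b - 1))
      = (x powr 1 * x powr (a - 1) * x powr (b - 1)) * (y powr (a - 1) * (1 - y) powr (b - 1))"
    using True assms by (simp add: powr_mult)
  also have "x powr 1 * x powr (a - 1) * x powr (b - 1) = x powr (a + b - 1)"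
    unfolding powr_add[symmetric] by (simp add: algebra_simps)
  finally have *: "x * ((x * y) powr (a - 1) * (x * (1 - y)) powr (b - 1))
      = x powr (a + b - 1) * (y powr (a - 1) * (1 - y) powr (b - 1))" .
  have e: "exp (- (x * y)) * exp (- (x * (1 - y))) = exp (- x)"
    by (simp add: algebra_simps flip: exp_add)
  have "x * (gamma_density a (x * y) * gamma_density b (x - x * y)) =
      (x * ((x * y) powr (a - 1) * (x * (1 - y)) powr (b - 1))) *
      (exp (- (x * y)) * exp (- (x * (1 - y)))) / (Gamma a * Gamma b)"
    using pos unfolding x1 by (simp add: gamma_density_def)
  also have "\<dots> = gamma_density (a + b) x * beta_density a b y"
    unfolding * e using True assms G(3)
    by (simp add: gamma_density_def beta_density_def Beta_def less_imp_neq[symmetric])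
  finally show ?thesis .
next
  case False
  then have "y \<le> 0 \<or> y \<ge> 1" by auto
  then have "x * y \<le> 0 \<or> x - x * y \<le> 0"
    using assms by (auto simp: mult_le_0_iff)
  then show ?thesis
    using False by (auto simp: gamma_density_def beta_density_def)
qed

text \<open>
  For independent \<open>g\<close> with law gamma(a) and \<open>v\<close> with law gamma(b), the sum \<open>g + v\<close> and the ratio
  \<open>g / (g + v)\<close> are independent with laws gamma(a + b) and beta(a, b). The substitution is made in
  one variable at a time: \<open>v = x - g\<close> for fixed \<open>g\<close>, then \<open>g = x * y\<close> for fixed \<open>x\<close>.
\<close>

lemma beta_gamma_algebra:
  fixes h :: "real \<Rightarrow> real \<Rightarrow> ennreal"
  assumes "a > 0" "b > 0"
    and [measurable]: "(\<lambda>(x, y). h x y) \<in> borel_measurable (borel \<Otimes>\<^sub>M borel)"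
  shows "(\<integral>\<^sup>+g. \<integral>\<^sup>+v. h (g + v) (g / (g + v)) \<partial>gamma_law b \<partial>gamma_law a)
    = (\<integral>\<^sup>+x. \<integral>\<^sup>+y. h x y \<partial>beta_law a b \<partial>gamma_law (a + b))"
proof -
  define k where "k = (\<lambda>g v. ennreal (gamma_density a g * gamma_density b v) * h (g + v) (g / (g + v)))"
  have k_measurable [measurable]: "(\<lambda>(g, v). k g v) \<in> borel_measurable (borel \<Otimes>\<^sub>M borel)"
    unfolding k_def by measurable
  have "(\<integral>\<^sup>+g. \<integral>\<^sup>+v. h (g + v) (g / (g + v)) \<partial>gamma_law b \<partial>gamma_law a)
      = (\<integral>\<^sup>+g. \<integral>\<^sup>+v. k g v \<partial>lborel \<partial>lborel)"
    using assms by (simp add: nn_integral_gamma_law k_def ennreal_mult gamma_density_nonneg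
        mult.assoc nn_integral_cmult)
  also have "\<dots> = (\<integral>\<^sup>+g. \<integral>\<^sup>+x. k g (x - g) \<partial>lborel \<partial>lborel)"
  proof (rule nn_integral_cong)
    fix g :: real
    show "(\<integral>\<^sup>+v. k g v \<partial>lborel) = (\<integral>\<^sup>+x. k g (x - g) \<partial>lborel)"
      using nn_integral_real_affine[of "k g" 1 "- g"] by simp
  qed
  also have "\<dots> = (\<integral>\<^sup>+x. \<integral>\<^sup>+g. k g (x - g) \<partial>lborel \<partial>lborel)"
    by (rule lborel_pair.Fubini') simp
  also have "\<dots> = (\<integral>\<^sup>+x. \<integral>\<^sup>+y. ennreal (gamma_density (a + b) x * beta_density a b y) * h x y
      \<partial>lborel \<partial>lborel)"
  proof (rule nn_integral_cong)
    fix x :: real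
    show "(\<integral>\<^sup>+g. k g (x - g) \<partial>lborel) =
      (\<integral>\<^sup>+y. ennreal (gamma_density (a + b) x * beta_density a b y) * h x y \<partial>lborel)"
    proof (cases "x > 0")
      case True
      have "(\<integral>\<^sup>+g. k g (x - g) \<partial>lborel) = ennreal x * (\<integral>\<^sup>+y. k (x * y) (x - x * y) \<partial>lborel)"
        using True by (subst nn_integral_real_affine[where c=x and t=0]) auto
      also have "\<dots> = (\<integral>\<^sup>+y. ennreal x * k (x * y) (x - x * y) \<partial>lborel)"
        by (rule nn_integral_cmult[symmetric]) simp
      also have "\<dots> = (\<integral>\<^sup>+y. ennreal (gamma_density (a + b) x * beta_density a b y) * h x y \<partial>lborel)"
      proof (rule nn_integral_cong)
        fix y :: real
        have "ennreal x * k (x * y) (x - x * y) =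
          ennreal (x * (gamma_density a (x * y) * gamma_density b (x - x * y))) * h x y"
          using True assms by (simp add: k_def ennreal_mult gamma_density_nonneg mult.assoc)
        then show "ennreal x * k (x * y) (x - x * y) =
          ennreal (gamma_density (a + b) x * beta_density a b y) * h x y"
          by (simp add: gamma_densities_product[OF assms(1,2) True])
      qed
      finally show ?thesis .
    next
      case False
      have "k g (x - g) = 0" for g
        using False by (auto simp: k_def gamma_density_def)
      then show ?thesis
        using False by (simp add: gamma_density_def)
    qed
  qed
  also have "\<dots> = (\<integral>\<^sup>+x. \<integral>\<^sup>+y. h x y \<partial>beta_law a b \<partial>gamma_law (a + b))"
    using assms by (simp add: nn_integral_gamma_law nn_integral_beta_law ennreal_mult'
        gamma_density_nonneg mult.assoc nn_integral_cmult)
  finally show ?thesis .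
qed

text \<open>
  Total mass 1 needs no evaluation of the beta integral: it is the case \<open>h = 1\<close> of the beta-gamma
  algebra.
\<close>

lemma prob_space_beta_law:
  assumes "a > 0" "b > 0"
  shows "prob_space (beta_law a b)"
proof
  interpret A: prob_space "gamma_law a" by (rule prob_space_gamma_law) fact
  interpret B: prob_space "gamma_law b" by (rule prob_space_gamma_law) fact
  interpret S: prob_space "gamma_law (a + b)" using assms by (intro prob_space_gamma_law) simp
  show "emeasure (beta_law a b) (space (beta_law a b)) = 1"
    using beta_gamma_algebra[OF assms, of "\<lambda>_ _. 1"]
      A.emeasure_space_1 B.emeasure_space_1 S.emeasure_space_1
    by simp
qed

text \<open>
  A beta(a, b) variable times an independent gamma(a + b) variable is gamma(a): apply the beta-gamma
  algebra to a function of the product \<open>x * y = g\<close>.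
\<close>

lemma beta_times_gamma:
  assumes "a > 0" "b > 0" and [measurable]: "f \<in> borel_measurable borel"
  shows "(\<integral>\<^sup>+u. \<integral>\<^sup>+r. f (u * r) \<partial>gamma_law (a + b) \<partial>beta_law a b) = (\<integral>\<^sup>+x. f x \<partial>gamma_law a)"
proof -
  interpret A: prob_space "gamma_law a" by (rule prob_space_gamma_law) fact
  interpret B: prob_space "gamma_law b" by (rule prob_space_gamma_law) fact
  interpret S: prob_space "gamma_law (a + b)" using assms by (intro prob_space_gamma_law) simp
  interpret T: prob_space "beta_law a b" using assms by (intro prob_space_beta_law)
  interpret ST: pair_sigma_finite "gamma_law (a + b)" "beta_law a b" ..
  have "(\<integral>\<^sup>+u. \<integral>\<^sup>+r. f (u * r) \<partial>gamma_law (a + b) \<partial>beta_law a b) =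
     (\<integral>\<^sup>+r. \<integral>\<^sup>+u. f (r * u) \<partial>beta_law a b \<partial>gamma_law (a + b))"
    by (subst ST.Fubini') (auto simp: mult.commute)
  also have "\<dots> = (\<integral>\<^sup>+g. \<integral>\<^sup>+v. f ((g + v) * (g / (g + v))) \<partial>gamma_law b \<partial>gamma_law a)"
    using assms by (subst beta_gamma_algebra) auto
  also have "\<dots> = (\<integral>\<^sup>+g. \<integral>\<^sup>+v. f g \<partial>gamma_law b \<partial>gamma_law a)"
    using AE_gamma_law_pos[of a]
  proof (rule nn_integral_cong_AE[OF eventually_mono])
    fix g :: real assume "g > 0"
    then show "(\<integral>\<^sup>+v. f ((g + v) * (g / (g + v))) \<partial>gamma_law b) = (\<integral>\<^sup>+v. f g \<partial>gamma_law b)"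
      by (intro nn_integral_cong_AE eventually_mono[OF AE_gamma_law_pos[of b]]) simp
  qed
  also have "\<dots> = (\<integral>\<^sup>+x. f x \<partial>gamma_law a)"
    using B.emeasure_space_1 by simp
  finally show ?thesis .
qed

lemma beta_law_mean:
  assumes "a > 0" "b > 0"
  shows "(\<integral>\<^sup>+u. ennreal u \<partial>beta_law a b) = ennreal (a / (a + b))"
proof -
  have "(\<integral>\<^sup>+u. ennreal u \<partial>beta_law a b) * ennreal (a + b)
      = (\<integral>\<^sup>+u. \<integral>\<^sup>+r. ennreal u * ennreal r \<partial>gamma_law (a + b) \<partial>beta_law a b)"
    using assms by (simp add: nn_integral_cmult gamma_law_mean nn_integral_multc del: ennreal_plus)
  also have "\<dots> = (\<integral>\<^sup>+u. \<integral>\<^sup>+r. ennreal (u * r) \<partial>gamma_law (a + b) \<partial>beta_law a b)"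
    using AE_gamma_law_pos[of "a + b"] AE_beta_law_pos[of a b]
    by (auto intro!: nn_integral_cong_AE simp: ennreal_mult elim!: eventually_mono)
  also have "\<dots> = ennreal a"
    using assms by (simp add: beta_times_gamma gamma_law_mean)
  finally have *: "(\<integral>\<^sup>+u. ennreal u \<partial>beta_law a b) * ennreal (a + b) = ennreal a" .
  \<comment> \<open>The mean of \<open>u * r\<close> was computed in two ways; divide by the mean \<open>a + b\<close> of \<open>r\<close>.\<close>
  then have "(\<integral>\<^sup>+u. ennreal u \<partial>beta_law a b) = ennreal a / ennreal (a + b)"
    using assms
    by (metis add_pos_pos ennreal_mult_divide_eq ennreal_neq_top ennreal_eq_0_iff not_le)
  also have "\<dots> = ennreal (a / (a + b))"
    using assms by (intro divide_ennreal) auto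
  finally show ?thesis .
qed

text \<open>
  One step of the recursion \<open>R n = G n + U n * R (n + 1)\<close> on the level of laws.
\<close>

lemma gamma_beta_renewal:
  fixes h :: "real \<Rightarrow> real \<Rightarrow> ennreal"
  assumes "c > 0" "a > 0" "b > 0"
    and [measurable]: "(\<lambda>(x, y). h x y) \<in> borel_measurable (borel \<Otimes>\<^sub>M borel)"
  shows "(\<integral>\<^sup>+g. \<integral>\<^sup>+u. \<integral>\<^sup>+r. h (g + u * r) (g / (g + u * r)) \<partial>gamma_law (a + b) \<partial>beta_law a b \<partial>gamma_law c)
    = (\<integral>\<^sup>+x. \<integral>\<^sup>+y. h x y \<partial>beta_law c a \<partial>gamma_law (c + a))"
proof -
  have "(\<integral>\<^sup>+u. \<integral>\<^sup>+r. h (g + u * r) (g / (g + u * r)) \<partial>gamma_law (a + b) \<partial>beta_law a b)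
      = (\<integral>\<^sup>+v. h (g + v) (g / (g + v)) \<partial>gamma_law a)" for g
    using assms(2,3) by (rule beta_times_gamma) measurable
  then show ?thesis
    using assms by (simp add: beta_gamma_algebra)
qed

section \<open>Decay of the mean remainder\<close>

text \<open>
  In terms of \<open>D m = (\<Prod>l=n..<n+m. a l / (a (l + 1) + c)) * (a (n + m) + c)\<close> one has
  \<open>D (m + 1) = D m * a (n + m) / (a (n + m) + c)\<close>. The factor \<open>1 + (\<Sum>j<m. c / a (n + j))\<close> keeps only the terms
  of \<open>\<Prod>j<m. (1 + c / a (n + j))\<close> that are at most linear in \<open>c\<close>; its divergence already
  forces \<open>D m\<close> to 0.
\<close>

lemma gamma_beta_product_bound:
  fixes a :: "nat \<Rightarrow> real" and c :: real
  assumes a: "\<And>j. j \<ge> n \<Longrightarrow> a j > 0" and c: "c > 0"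
  shows "(\<Prod>l=n..<n+m. a l / (a (Suc l) + c)) * (a (n + m) + c) * (1 + (\<Sum>j<m. c / a (n + j)))
    \<le> a n + c"
proof (induction m)
  case 0
  show ?case by simp
next
  case (Suc m)
  define p where "p = (\<Prod>l=n..<n+m. a l / (a (Suc l) + c))"
  define S where "S = (\<Sum>j<m. c / a (n + j))"
  have pos: "a (n + m) > 0" "a (Suc (n + m)) > 0" using a by auto
  have factor_nonneg: "0 \<le> a l / (a (Suc l) + c)" if "l \<ge> n" for l
    using a[of l] a[of "Suc l"] that c by simp
  have "p \<ge> 0" unfolding p_def using factor_nonneg by (intro prod_nonneg) auto
  have "S \<ge> 0" unfolding S_def using a c by (intro sum_nonneg) (auto intro!: divide_nonneg_nonneg less_imp_le)
  have "(\<Prod>l=n..<n + Suc m. a l / (a (Suc l) + c)) * (a (n + Suc m) + c) *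
      (1 + (\<Sum>j<Suc m. c / a (n + j))) = p * (a (n + m) * (1 + S + c / a (n + m)))"
    using pos c by (simp add: p_def S_def)
  also have "a (n + m) * (1 + S + c / a (n + m)) = a (n + m) * (1 + S) + c"
    using pos by (simp add: field_simps)
  also have "p * \<dots> \<le> p * ((a (n + m) + c) * (1 + S))"
    using \<open>p \<ge> 0\<close> \<open>S \<ge> 0\<close> c by (intro mult_left_mono) (auto simp: algebra_simps)
  also have "\<dots> \<le> a n + c"
    using Suc.IH by (simp add: p_def S_def mult.assoc)
  finally show ?case .
qed

lemma gamma_beta_product_tendsto_0:
  fixes a :: "nat \<Rightarrow> real" and c K :: real
  assumes a: "\<And>j. j \<ge> n \<Longrightarrow> a j > 0" and c: "c > 0"
    and K: "\<And>j. j \<ge> n \<Longrightarrow> a j \<le> K * real j" and n: "n \<ge> 1"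
  shows "(\<lambda>m. (\<Prod>l=n..<n+m. a l / (a (Suc l) + c)) * (a (n + m) + c)) \<longlonglongrightarrow> 0"
proof (rule tendsto_sandwich)
  define S where "S = (\<lambda>m. \<Sum>j<m. c / a (n + j))"
  have "a n \<le> K * real n" "a n > 0" using a K by auto
  then have "K > 0" using n by (metis less_le_trans of_nat_0_le_iff zero_less_mult_pos2 mult_nonpos_nonneg not_le)
  have S0: "S m \<ge> 0" for m
    unfolding S_def using a c by (intro sum_nonneg) (auto intro!: divide_nonneg_nonneg less_imp_le)
  \<comment> \<open>Since \<open>n + j \<le> n (j + 1)\<close>, the sum dominates a multiple of a harmonic sum.\<close>
  have "(c / (K * n)) * harm m \<le> S m" for m
  proof -
    have "(c / (K * n)) * harm m = (\<Sum>j<m. c / (K * n) * inverse (real (Suc j)))"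
      unfolding harm_def sum_distrib_left One_nat_def sum.atLeast1_atMost_eq ..
    also have "\<dots> \<le> S m"
      unfolding S_def
    proof (rule sum_mono)
      fix j
      have "a (n + j) \<le> K * real (n + j)" by (rule K) simp
      also have "\<dots> \<le> K * (real n * real (Suc j))"
      proof -
        have "n + j \<le> n * Suc j" using n by simp
        then have "real (n + j) \<le> real n * real (Suc j)"
          by (metis of_nat_le_iff of_nat_mult)
        then show ?thesis using \<open>K > 0\<close> by (intro mult_left_mono) auto
      qed
      finally have "c / (K * (real n * real (Suc j))) \<le> c / a (n + j)"
        using a c by (intro divide_left_mono) (auto intro!: mult_pos_pos simp: \<open>K > 0\<close> less_le_trans[OF _ n])
      then show "c / (K * n) * inverse (real (Suc j)) \<le> c / a (n + j)"
        by (simp add: field_simps)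
    qed
    finally show ?thesis .
  qed
  moreover have "filterlim (\<lambda>m. c / (K * n) * harm m) at_top sequentially"
    using c n \<open>K > 0\<close> by (intro filterlim_tendsto_pos_mult_at_top[OF tendsto_const _ harm_at_top]) auto
  ultimately have S_lim: "filterlim S at_top sequentially"
    by (auto intro: filterlim_at_top_mono)
  show "\<forall>\<^sub>F m in sequentially. (\<Prod>l=n..<n+m. a l / (a (Suc l) + c)) * (a (n + m) + c)
      \<le> (a n + c) / (1 + S m)"
    using gamma_beta_product_bound[of n a c, OF a c] S0
    by (auto simp: S_def field_simps add_pos_nonneg)
  show "\<forall>\<^sub>F m in sequentially. 0 \<le> (\<Prod>l=n..<n+m. a l / (a (Suc l) + c)) * (a (n + m) + c)"
  proof (intro always_eventually allI mult_nonneg_nonneg prod_nonneg ballI)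
    fix m l assume "l \<in> {n..<n + m}"
    then show "0 \<le> a l / (a (Suc l) + c)" using a[of l] a[of "Suc l"] c by simp
  next
    fix m show "0 \<le> a (n + m) + c" using a[of "n + m"] c by simp
  qed
  show "(\<lambda>m. (a n + c) / (1 + S m)) \<longlonglongrightarrow> 0"
    by (intro tendsto_divide_0[OF tendsto_const] filterlim_at_top_imp_at_infinity
        filterlim_tendsto_add_at_top[OF tendsto_const S_lim])
qed simp

section \<open>Weights, partial sums, tails and sticks\<close>

text \<open>
  A realisation of all the variables is one function \<open>z\<close> on \<open>nat + nat\<close>: \<open>z (Inl j)\<close> is the value of
  \<open>G j\<close> and \<open>z (Inr j)\<close> the value of \<open>U j\<close>. The weight \<open>weight n m z\<close> is the product
  \<open>U n * \<dots> * U (n + m - 1)\<close>.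
\<close>

definition weight :: "nat \<Rightarrow> nat \<Rightarrow> (nat + nat \<Rightarrow> real) \<Rightarrow> real" where
  "weight n m z = (\<Prod>l=n..<n+m. z (Inr l))"

text \<open>
  The first \<open>m\<close> terms of the series started at index \<open>n\<close>.
\<close>

definition partial :: "nat \<Rightarrow> nat \<Rightarrow> (nat + nat \<Rightarrow> real) \<Rightarrow> real" where
  "partial n m z = (\<Sum>j<m. z (Inl (n + j)) * weight n j z)"

text \<open>
  The sum \<open>R n\<close> of the series started at index \<open>n\<close>. It is meaningful only where that series
  converges, but it is a measurable function everywhere.
\<close>

definition tail :: "nat \<Rightarrow> (nat + nat \<Rightarrow> real) \<Rightarrow> real" where
  "tail n z = (\<Sum>j. z (Inl (n + j)) * weight n j z)"

text \<open>
  The stick \<open>Y n = G n / R n\<close>.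
\<close>

definition stick :: "nat \<Rightarrow> (nat + nat \<Rightarrow> real) \<Rightarrow> real" where
  "stick n z = z (Inl n) / tail n z"

lemma weight_0 [simp]: "weight n 0 z = 1"
  by (simp add: weight_def)

lemma weight_Suc: "weight n (Suc m) z = z (Inr n) * weight (Suc n) m z"
  by (simp add: weight_def prod.atLeast_Suc_lessThan)

lemma partial_0 [simp]: "partial n 0 z = 0"
  by (simp add: partial_def)

lemma partial_Suc: "partial n (Suc m) z = z (Inl n) + z (Inr n) * partial (Suc n) m z"
  unfolding partial_def
  by (simp add: sum.lessThan_Suc_shift weight_Suc sum_distrib_left mult_ac del: sum.lessThan_Suc)

lemma tail_unfold:
  assumes "summable (\<lambda>j. z (Inl (Suc n + j)) * weight (Suc n) j z)"
  shows "tail n z = z (Inl n) + z (Inr n) * tail (Suc n) z"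
proof -
  have e: "(\<lambda>j. z (Inl (n + Suc j)) * weight n (Suc j) z)
      = (\<lambda>j. z (Inr n) * (z (Inl (Suc n + j)) * weight (Suc n) j z))"
    by (simp add: weight_Suc mult_ac)
  have "summable (\<lambda>j. z (Inl (n + Suc j)) * weight n (Suc j) z)"
    unfolding e by (intro summable_mult assms)
  then have "summable (\<lambda>j. z (Inl (n + j)) * weight n j z)"
    by (subst (asm) summable_Suc_iff)
  from suminf_split_head[OF this] show ?thesis
    unfolding tail_def e using assms by (simp add: suminf_mult)
qed

text \<open>
  The indices of the variables \<open>G j\<close> and \<open>U j\<close> with \<open>j \<ge> n\<close>.
\<close>

definition indices_from :: "nat \<Rightarrow> (nat + nat) set" where
  "indices_from n = {n..} <+> {n..}"

lemma indices_from_iff [simp]: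
  "Inl k \<in> indices_from n \<longleftrightarrow> n \<le> k" "Inr k \<in> indices_from n \<longleftrightarrow> n \<le> k"
  by (auto simp: indices_from_def)

lemma weight_measurable [measurable]:
  "n \<le> k \<Longrightarrow> weight k m \<in> borel_measurable (PiM (indices_from n) (\<lambda>_. borel))"
  unfolding weight_def[abs_def]
  by (intro borel_measurable_prod measurable_component_singleton) auto

lemma partial_measurable [measurable]:
  "n \<le> k \<Longrightarrow> partial k m \<in> borel_measurable (PiM (indices_from n) (\<lambda>_. borel))"
  unfolding partial_def[abs_def]
  by (intro borel_measurable_sum borel_measurable_times weight_measurable measurable_component_singleton) auto

lemma tail_measurable [measurable]:
  "n \<le> k \<Longrightarrow> tail k \<in> borel_measurable (PiM (indices_from n) (\<lambda>_. borel))"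
  unfolding tail_def[abs_def]
  by (intro borel_measurable_suminf borel_measurable_times weight_measurable measurable_component_singleton) auto

lemma stick_measurable [measurable]:
  "n \<le> k \<Longrightarrow> stick k \<in> borel_measurable (PiM (indices_from n) (\<lambda>_. borel))"
  unfolding stick_def[abs_def]
  by (intro borel_measurable_divide tail_measurable measurable_component_singleton) auto

text \<open>
  The functionals with lower index \<open>k \<ge> n\<close> see only the coordinates in \<open>indices_from n\<close>. Together
  with measurability on the corresponding product space this makes independence of disjoint blocks
  of variables applicable to them.
\<close>

lemma weight_restrict: "n \<le> k \<Longrightarrow> weight k m (restrict z (indices_from n)) = weight k m z"
  by (simp add: weight_def)

lemma partial_restrict: "n \<le> k \<Longrightarrow> partial k m (restrict z (indices_from n)) = partial k m z"
  by (simp add: partial_def weight_restrict)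

lemma tail_restrict: "n \<le> k \<Longrightarrow> tail k (restrict z (indices_from n)) = tail k z"
  by (simp add: tail_def weight_restrict)

lemma stick_restrict: "n \<le> k \<Longrightarrow> stick k (restrict z (indices_from n)) = stick k z"
  by (simp add: stick_def tail_restrict)

section \<open>Integrating out single variables\<close>

text \<open>
  Fubini's theorem for one variable \<open>X i\<close> and a functional \<open>F\<close> of the variables in a block \<open>J\<close> that does
  not contain \<open>i\<close>: the variable can be integrated out against its own law.
\<close>

lemma (in prob_space) indep_component_nn_integral:
  fixes X :: "'i \<Rightarrow> 'a \<Rightarrow> real"
  assumes indep: "indep_vars (\<lambda>_. borel) X I" and ij: "i \<in> I" "i \<notin> J" "J \<subseteq> I"
    and F [measurable]: "F \<in> PiM J (\<lambda>_. borel) \<rightarrow>\<^sub>M N"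
    and F_restrict: "\<And>z. F (restrict z J) = F z"
    and h [measurable]: "(\<lambda>(x, y). h x y) \<in> borel_measurable (borel \<Otimes>\<^sub>M N)"
  shows "(\<integral>\<^sup>+\<omega>. h (X i \<omega>) (F (\<lambda>j. X j \<omega>)) \<partial>M) =
    (\<integral>\<^sup>+x. \<integral>\<^sup>+\<omega>. h x (F (\<lambda>j. X j \<omega>)) \<partial>M \<partial>distr M borel (X i))"
proof -
  have [measurable]: "X j \<in> borel_measurable M" if "j \<in> I" for j
    using indep that by (auto simp: indep_vars_def2)
  let ?P = "PiM {i} (\<lambda>_. borel :: real measure)" and ?Q = "PiM J (\<lambda>_. borel :: real measure)"
  let ?x = "\<lambda>\<omega>. restrict (\<lambda>j. X j \<omega>) {i}" and ?y = "\<lambda>\<omega>. restrict (\<lambda>j. X j \<omega>) J"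
  have rv [measurable]: "?x \<in> M \<rightarrow>\<^sub>M ?P" "?y \<in> M \<rightarrow>\<^sub>M ?Q"
    and prod: "distr M ?P ?x \<Otimes>\<^sub>M distr M ?Q ?y = distr M (?P \<Otimes>\<^sub>M ?Q) (\<lambda>\<omega>. (?x \<omega>, ?y \<omega>))"
    using indep_var_restrict[OF indep, of "{i}" J] ij unfolding indep_var_distribution_eq by auto
  interpret D: prob_space "distr M ?Q ?y"
    by (rule prob_space_distr) measurable
  have [measurable]: "(\<lambda>p. p i) \<in> ?P \<rightarrow>\<^sub>M borel"
    by (rule measurable_component_singleton) simp
  have Fy: "F (?y \<omega>) = F (\<lambda>j. X j \<omega>)" for \<omega>
    by (rule F_restrict)
  have [measurable]: "(\<lambda>\<omega>. F (\<lambda>j. X j \<omega>)) \<in> M \<rightarrow>\<^sub>M N"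
    using measurable_compose[OF rv(2) F] by (simp add: Fy)
  have [measurable]: "X i \<in> borel_measurable M"
    using ij by simp
  have "(\<integral>\<^sup>+\<omega>. h (X i \<omega>) (F (\<lambda>j. X j \<omega>)) \<partial>M) =
      (\<integral>\<^sup>+p. h (fst p i) (F (snd p)) \<partial>distr M (?P \<Otimes>\<^sub>M ?Q) (\<lambda>\<omega>. (?x \<omega>, ?y \<omega>)))"
    by (subst nn_integral_distr) (simp_all add: Fy)
  also have "\<dots> = (\<integral>\<^sup>+p. \<integral>\<^sup>+q. h (p i) (F q) \<partial>distr M ?Q ?y \<partial>distr M ?P ?x)"
    unfolding prod[symmetric] by (subst D.nn_integral_fst[symmetric]) simp_all
  also have "\<dots> = (\<integral>\<^sup>+\<omega>'. \<integral>\<^sup>+\<omega>. h (X i \<omega>') (F (\<lambda>j. X j \<omega>)) \<partial>M \<partial>M)"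
    by (simp add: nn_integral_distr Fy)
  also have "\<dots> = (\<integral>\<^sup>+x. \<integral>\<^sup>+\<omega>. h x (F (\<lambda>j. X j \<omega>)) \<partial>M \<partial>distr M borel (X i))"
    by (subst nn_integral_distr) simp_all
  finally show ?thesis .
qed

section \<open>The gamma and beta sequences\<close>

text \<open>
  The setting: independent variables \<open>X (Inl n)\<close> with law gamma(c) and \<open>X (Inr n)\<close> with law
  beta(a n, c + \<alpha>), for \<open>n \<ge> 1\<close>. The values at index 0 play no role.
\<close>

locale gamma_beta_sequence = prob_space M
  for M :: "'w measure" +
  fixes \<alpha> c :: real and a :: "nat \<Rightarrow> real" and X :: "nat + nat \<Rightarrow> 'w \<Rightarrow> real"
  assumes alpha_nonneg: "\<alpha> \<ge> 0" and a1_pos: "a 1 > 0" and c_pos: "c > 0"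
    and a_eq: "\<And>n. n \<ge> 1 \<Longrightarrow> a n = a 1 + (real n - 1) * \<alpha>"
    and distr_Inl: "\<And>n. n \<ge> 1 \<Longrightarrow> distr M borel (X (Inl n)) = gamma_law c"
    and distr_Inr: "\<And>n. n \<ge> 1 \<Longrightarrow> distr M borel (X (Inr n)) = beta_law (a n) (c + \<alpha>)"
    and indep: "indep_vars (\<lambda>_. borel) X (indices_from 1)"
begin

text \<open>
  The realisation of all the variables at the point \<open>\<omega>\<close> of the probability space.
\<close>

abbreviation sample :: "'w \<Rightarrow> nat + nat \<Rightarrow> real" where
  "sample \<omega> \<equiv> \<lambda>i. X i \<omega>"

lemma a_pos: "n \<ge> 1 \<Longrightarrow> a n > 0"
  using a1_pos alpha_nonneg a_eq[of n] by (auto intro!: add_pos_nonneg)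

lemma a_Suc: "n \<ge> 1 \<Longrightarrow> a (Suc n) = a n + \<alpha>"
  using a_eq[of n] a_eq[of "Suc n"] by (simp add: algebra_simps)

lemma a_le: "n \<ge> 1 \<Longrightarrow> a n \<le> (a 1 + \<alpha>) * real n"
proof -
  assume n: "n \<ge> 1"
  have "a 1 \<le> a 1 * real n" using n a1_pos by simp
  then show ?thesis using a_eq[OF n] alpha_nonneg by (simp add: algebra_simps)
qed

lemma X_measurable [measurable]: "i \<in> indices_from 1 \<Longrightarrow> X i \<in> borel_measurable M"
  using indep by (auto simp: indep_vars_def2)

lemma sample_functional_measurable:
  assumes F: "F \<in> PiM (indices_from n) (\<lambda>_. borel) \<rightarrow>\<^sub>M N" and "n \<ge> 1"
    and F_restrict: "\<And>z. F (restrict z (indices_from n)) = F z"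
  shows "(\<lambda>\<omega>. F (sample \<omega>)) \<in> M \<rightarrow>\<^sub>M N"
proof -
  have "i \<in> indices_from 1" if "i \<in> indices_from n" for i
    using that \<open>n \<ge> 1\<close> by (auto simp: indices_from_def)
  then have "(\<lambda>\<omega>. restrict (sample \<omega>) (indices_from n)) \<in> M \<rightarrow>\<^sub>M PiM (indices_from n) (\<lambda>_. borel)"
    by (intro measurable_restrict X_measurable)
  from measurable_compose[OF this F] show ?thesis
    by (simp add: F_restrict)
qed

lemma sample_measurable [measurable]:
  assumes "n \<ge> 1"
  shows "(\<lambda>\<omega>. weight n m (sample \<omega>)) \<in> borel_measurable M"
    and "(\<lambda>\<omega>. partial n m (sample \<omega>)) \<in> borel_measurable M"
    and "(\<lambda>\<omega>. tail n (sample \<omega>)) \<in> borel_measurable M"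
    and "(\<lambda>\<omega>. stick n (sample \<omega>)) \<in> borel_measurable M"
  using assms
  by (auto intro!: sample_functional_measurable[where n=n and F="weight n m"]
      sample_functional_measurable[where n=n and F="partial n m"]
      sample_functional_measurable[where n=n and F="tail n"]
      sample_functional_measurable[where n=n and F="stick n"]
      simp: weight_restrict partial_restrict tail_restrict stick_restrict)

lemma AE_pos: "AE \<omega> in M. \<forall>n\<ge>1. X (Inl n) \<omega> > 0 \<and> X (Inr n) \<omega> > 0"
proof -
  have "AE \<omega> in M. X (Inl n) \<omega> > 0 \<and> X (Inr n) \<omega> > 0" if "n \<ge> 1" for n
  proof -
    have "AE x in distr M borel (X (Inl n)). x > 0" "AE x in distr M borel (X (Inr n)). x > 0"
      unfolding distr_Inl[OF that] distr_Inr[OF that] by (rule AE_gamma_law_pos AE_beta_law_pos)+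
    then show ?thesis
      using that by (auto simp: AE_distr_iff)
  qed
  then have "AE \<omega> in M. n \<ge> 1 \<longrightarrow> X (Inl n) \<omega> > 0 \<and> X (Inr n) \<omega> > 0" for n
    by (cases "n \<ge> 1") auto
  then show ?thesis by (simp add: AE_all_countable)
qed

lemma weight_pos:
  "\<lbrakk>\<forall>n\<ge>1. X (Inl n) \<omega> > 0 \<and> X (Inr n) \<omega> > 0; n \<ge> 1\<rbrakk> \<Longrightarrow> weight n m (sample \<omega>) > 0"
  unfolding weight_def by (intro prod_pos) auto

text \<open>
  Integrating out \<open>G n\<close> and \<open>U n\<close> in front of a functional \<open>F\<close> of the variables with larger index.
\<close>

lemma nn_integral_first_pair:
  assumes n: "n \<ge> 1"
    and F [measurable]: "F \<in> PiM (indices_from (Suc n)) (\<lambda>_. borel) \<rightarrow>\<^sub>M N"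
    and F_restrict: "\<And>z. F (restrict z (indices_from (Suc n))) = F z"
    and h [measurable]: "(\<lambda>(g, u, y). h g u y) \<in> borel_measurable (borel \<Otimes>\<^sub>M borel \<Otimes>\<^sub>M N)"
  shows "(\<integral>\<^sup>+\<omega>. h (X (Inl n) \<omega>) (X (Inr n) \<omega>) (F (sample \<omega>)) \<partial>M) =
    (\<integral>\<^sup>+g. \<integral>\<^sup>+u. \<integral>\<^sup>+\<omega>. h g u (F (sample \<omega>)) \<partial>M \<partial>beta_law (a n) (c + \<alpha>) \<partial>gamma_law c)"
proof -
  define J where "J = insert (Inr n) (indices_from (Suc n))"
  \<comment> \<open>First \<open>G n\<close> is integrated out, with \<open>U n\<close> counted among the remaining variables, then \<open>U n\<close>.\<close>
  define F' where "F' z = (z (Inr n), F z)" for z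
  have J: "J \<subseteq> indices_from 1" "indices_from (Suc n) \<subseteq> indices_from 1" "Inl n \<notin> J"
    using n by (auto simp: J_def indices_from_def)
  have "(\<lambda>z. F (restrict z (indices_from (Suc n)))) \<in> PiM J (\<lambda>_. borel) \<rightarrow>\<^sub>M N"
    by (rule measurable_compose[OF measurable_restrict_subset F]) (auto simp: J_def)
  then have F_J [measurable]: "F \<in> PiM J (\<lambda>_. borel) \<rightarrow>\<^sub>M N"
    by (simp add: F_restrict)
  have F': "F' \<in> PiM J (\<lambda>_. borel) \<rightarrow>\<^sub>M borel \<Otimes>\<^sub>M N"
    unfolding F'_def by (intro measurable_Pair measurable_component_singleton F_J) (simp add: J_def)
  have F'_restrict: "F' (restrict z J) = F' z" for z
  proof -
    have "restrict (restrict z J) (indices_from (Suc n)) = restrict z (indices_from (Suc n))"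
      by (auto simp: J_def fun_eq_iff restrict_def)
    then have "F (restrict z J) = F z"
      by (metis F_restrict)
    then show ?thesis by (simp add: F'_def J_def)
  qed
  have "(\<integral>\<^sup>+\<omega>. h (X (Inl n) \<omega>) (X (Inr n) \<omega>) (F (sample \<omega>)) \<partial>M) =
      (\<integral>\<^sup>+\<omega>. (\<lambda>g (u, y). h g u y) (X (Inl n) \<omega>) (F' (sample \<omega>)) \<partial>M)"
    by (simp add: F'_def)
  also have "\<dots> = (\<integral>\<^sup>+g. \<integral>\<^sup>+\<omega>. (\<lambda>g (u, y). h g u y) g (F' (sample \<omega>)) \<partial>M \<partial>distr M borel (X (Inl n)))"
    using n J by (intro indep_component_nn_integral[OF indep, where J=J, OF _ _ _ F' F'_restrict]) auto
  also have "\<dots> = (\<integral>\<^sup>+g. \<integral>\<^sup>+\<omega>. h g (X (Inr n) \<omega>) (F (sample \<omega>)) \<partial>M \<partial>gamma_law c)"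
    using n by (simp add: F'_def distr_Inl)
  also have "\<dots> = (\<integral>\<^sup>+g. \<integral>\<^sup>+u. \<integral>\<^sup>+\<omega>. h g u (F (sample \<omega>)) \<partial>M \<partial>beta_law (a n) (c + \<alpha>) \<partial>gamma_law c)"
  proof (rule nn_integral_cong)
    fix g :: real
    have "(\<integral>\<^sup>+\<omega>. h g (X (Inr n) \<omega>) (F (sample \<omega>)) \<partial>M) =
        (\<integral>\<^sup>+u. \<integral>\<^sup>+\<omega>. h g u (F (sample \<omega>)) \<partial>M \<partial>distr M borel (X (Inr n)))"
      using n J
      by (intro indep_component_nn_integral[OF indep, where J="indices_from (Suc n)", OF _ _ _ F F_restrict])
        auto
    then show "(\<integral>\<^sup>+\<omega>. h g (X (Inr n) \<omega>) (F (sample \<omega>)) \<partial>M) =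
        (\<integral>\<^sup>+u. \<integral>\<^sup>+\<omega>. h g u (F (sample \<omega>)) \<partial>M \<partial>beta_law (a n) (c + \<alpha>))"
      by (simp only: distr_Inr[OF n])
  qed
  finally show ?thesis .
qed

section \<open>The law of the tail\<close>

lemma weight_expectation:
  "n \<ge> 1 \<Longrightarrow> (\<integral>\<^sup>+\<omega>. ennreal (weight n m (sample \<omega>)) \<partial>M)
    = ennreal (\<Prod>l=n..<n+m. a l / (a (Suc l) + c))"
proof (induction m arbitrary: n)
  case 0
  show ?case by (simp add: emeasure_space_1)
next
  case (Suc m)
  have J: "indices_from (Suc n) \<subseteq> indices_from 1" "Inr n \<notin> indices_from (Suc n)"
    by (auto simp: indices_from_def)
  have "(\<integral>\<^sup>+\<omega>. ennreal (weight n (Suc m) (sample \<omega>)) \<partial>M)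
    = (\<integral>\<^sup>+\<omega>. ennreal (X (Inr n) \<omega> * weight (Suc n) m (sample \<omega>)) \<partial>M)"
    by (simp add: weight_Suc)
  also have "\<dots> = (\<integral>\<^sup>+u. \<integral>\<^sup>+\<omega>. ennreal (u * weight (Suc n) m (sample \<omega>)) \<partial>M
      \<partial>beta_law (a n) (c + \<alpha>))"
    unfolding distr_Inr[OF Suc.prems, symmetric] using Suc.prems J
    by (intro indep_component_nn_integral[OF indep, where J="indices_from (Suc n)" and N=borel
          and F="weight (Suc n) m" and h="\<lambda>u q. ennreal (u * q)"])
      (auto simp: weight_restrict)
  also have "\<dots> = (\<integral>\<^sup>+u. ennreal u * ennreal (\<Prod>l=Suc n..<Suc n+m. a l / (a (Suc l) + c))
      \<partial>beta_law (a n) (c + \<alpha>))"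
    using AE_beta_law_pos
    by (rule nn_integral_cong_AE[OF eventually_mono])
      (simp add: ennreal_mult' nn_integral_cmult Suc.IH del: prod.op_ivl_Suc)
  also have "\<dots> = ennreal (a n / (a n + (c + \<alpha>))) * ennreal (\<Prod>l=Suc n..<Suc n+m. a l / (a (Suc l) + c))"
    using Suc.prems a_pos[of n] c_pos alpha_nonneg
    by (subst nn_integral_multc) (auto simp: beta_law_mean)
  also have "\<dots> = ennreal (\<Prod>l=n..<n+Suc m. a l / (a (Suc l) + c))"
    using Suc.prems a_pos[of n] c_pos alpha_nonneg
    by (subst ennreal_mult'[symmetric]) (auto simp: prod.atLeast_Suc_lessThan a_Suc algebra_simps)
  finally show ?case .
qed

text \<open>
  If the tail \<open>R (n + m)\<close> in \<open>R n = (\<Sum>j<m. \<dots>) + U n * \<dots> * U (n + m - 1) * R (n + m)\<close> is replaced by an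
  independent gamma(c + a (n + m)) variable \<open>w\<close>, the sum has law gamma(c + a n). The induction strips
  off the first pair \<open>(G n, U n)\<close>, so that each step is a renewal step.
\<close>

lemma closed_partial_sum_law:
  fixes f :: "real \<Rightarrow> ennreal"
  assumes [measurable]: "f \<in> borel_measurable borel" and "n \<ge> 1"
  shows "(\<integral>\<^sup>+\<omega>. \<integral>\<^sup>+w. f (partial n m (sample \<omega>) + weight n m (sample \<omega>) * w)
      \<partial>gamma_law (c + a (n + m)) \<partial>M) = (\<integral>\<^sup>+x. f x \<partial>gamma_law (c + a n))"
  using assms
proof (induction m arbitrary: n f)
  case 0
  show ?case by (simp add: emeasure_space_1)
next
  case (Suc m)
  note [measurable] = Suc.prems(1)
  have n: "n \<ge> 1" by fact
  have an: "a n > 0" "a (Suc n) > 0" "c + a (Suc n) = a n + (c + \<alpha>)" using a_pos[of n] a_pos[of "Suc n"] a_Suc[of n] n by auto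
  interpret W: prob_space "gamma_law (c + a (Suc n + m))"
    using a_pos[of "Suc n + m"] c_pos by (intro prob_space_gamma_law) simp
  interpret B: prob_space "beta_law c (a n)"
    using an c_pos by (intro prob_space_beta_law)
  have [measurable]: "(\<lambda>(g, u, y). case y of (t, q) \<Rightarrow> \<integral>\<^sup>+w. f (g + u * (t + q * w))
      \<partial>gamma_law (c + a (Suc n + m))) \<in> borel_measurable (borel \<Otimes>\<^sub>M borel \<Otimes>\<^sub>M borel \<Otimes>\<^sub>M borel)"
    by measurable
  have "(\<integral>\<^sup>+\<omega>. \<integral>\<^sup>+w. f (partial n (Suc m) (sample \<omega>) + weight n (Suc m) (sample \<omega>) * w)
      \<partial>gamma_law (c + a (n + Suc m)) \<partial>M) =
    (\<integral>\<^sup>+\<omega>. (\<lambda>g u (t, q). \<integral>\<^sup>+w. f (g + u * (t + q * w)) \<partial>gamma_law (c + a (Suc n + m)))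
      (X (Inl n) \<omega>) (X (Inr n) \<omega>) (partial (Suc n) m (sample \<omega>), weight (Suc n) m (sample \<omega>)) \<partial>M)"
    by (simp add: partial_Suc weight_Suc algebra_simps)
  also have "\<dots> = (\<integral>\<^sup>+g. \<integral>\<^sup>+u. \<integral>\<^sup>+\<omega>.
      (\<lambda>g u (t, q). \<integral>\<^sup>+w. f (g + u * (t + q * w)) \<partial>gamma_law (c + a (Suc n + m)))
      g u (partial (Suc n) m (sample \<omega>), weight (Suc n) m (sample \<omega>)) \<partial>M
      \<partial>beta_law (a n) (c + \<alpha>) \<partial>gamma_law c)"
    using n by (intro nn_integral_first_pair[where N="borel \<Otimes>\<^sub>M borel"
        and F="\<lambda>z. (partial (Suc n) m z, weight (Suc n) m z)"])
      (simp_all add: partial_restrict weight_restrict del: add_Suc)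
  also have "\<dots> = (\<integral>\<^sup>+g. \<integral>\<^sup>+u. \<integral>\<^sup>+r. f (g + u * r) \<partial>gamma_law (c + a (Suc n))
      \<partial>beta_law (a n) (c + \<alpha>) \<partial>gamma_law c)"
    unfolding prod.case
    by (intro nn_integral_cong Suc.IH) auto
  also have "\<dots> = (\<integral>\<^sup>+x. \<integral>\<^sup>+y. f x \<partial>beta_law c (a n) \<partial>gamma_law (c + a n))"
    unfolding an using an c_pos alpha_nonneg
    by (subst gamma_beta_renewal[where h="\<lambda>x y. f x", symmetric]) auto
  also have "\<dots> = (\<integral>\<^sup>+x. f x \<partial>gamma_law (c + a n))"
    using B.emeasure_space_1 by simp
  finally show ?case .
qed

end

lemma norm_iexp_diff_le: "norm (iexp x - iexp y) \<le> \<bar>x - y\<bar>"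
proof -
  have "iexp x - iexp y = iexp y * (iexp (x - y) - 1)"
    by (simp add: algebra_simps flip: exp_add)
  then show ?thesis
    using iexp_approx1[of "x - y" 0] by (simp add: norm_mult)
qed

context gamma_beta_sequence
begin

text \<open>
  The partial sums are dominated by the closed partial sums, whose mean is \<open>c + a n\<close> for every
  \<open>m\<close>; so the whole series has finite mean.
\<close>

lemma AE_summable_tail:
  assumes n: "n \<ge> 1"
  shows "AE \<omega> in M. summable (\<lambda>j. X (Inl (n + j)) \<omega> * weight n j (sample \<omega>))"
proof -
  let ?t = "\<lambda>j \<omega>. X (Inl (n + j)) \<omega> * weight n j (sample \<omega>)"
  have [measurable]: "?t j \<in> borel_measurable M" for j
    using n by (intro borel_measurable_times X_measurable sample_measurable) simp_all
  have t_nonneg: "AE \<omega> in M. \<forall>j. ?t j \<omega> \<ge> 0"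
    using AE_pos
  proof (rule eventually_mono)
    fix \<omega> assume *: "\<forall>n\<ge>1. X (Inl n) \<omega> > 0 \<and> X (Inr n) \<omega> > 0"
    show "\<forall>j. ?t j \<omega> \<ge> 0"
    proof
      fix j
      have "X (Inl (n + j)) \<omega> > 0" using * n by simp
      then show "?t j \<omega> \<ge> 0"
        using weight_pos[OF * n, of j] by simp
    qed
  qed
  have bound: "(\<Sum>j<m. \<integral>\<^sup>+\<omega>. ennreal (?t j \<omega>) \<partial>M) \<le> ennreal (c + a n)" for m
  proof -
    interpret W: prob_space "gamma_law (c + a (n + m))"
      using a_pos[of "n + m"] c_pos n by (intro prob_space_gamma_law) simp
    have "(\<Sum>j<m. \<integral>\<^sup>+\<omega>. ennreal (?t j \<omega>) \<partial>M) = (\<integral>\<^sup>+\<omega>. (\<Sum>j<m. ennreal (?t j \<omega>)) \<partial>M)"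
      by (rule nn_integral_sum[symmetric]) measurable
    also have "\<dots> = (\<integral>\<^sup>+\<omega>. ennreal (partial n m (sample \<omega>)) \<partial>M)"
      using t_nonneg
      by (rule nn_integral_cong_AE[OF eventually_mono]) (simp add: partial_def sum_ennreal)
    also have "\<dots> = (\<integral>\<^sup>+\<omega>. \<integral>\<^sup>+w. ennreal (partial n m (sample \<omega>)) \<partial>gamma_law (c + a (n + m)) \<partial>M)"
      using W.emeasure_space_1 by simp
    also have "\<dots> \<le> (\<integral>\<^sup>+\<omega>. \<integral>\<^sup>+w. ennreal (partial n m (sample \<omega>) + weight n m (sample \<omega>) * w)
        \<partial>gamma_law (c + a (n + m)) \<partial>M)"
      using AE_pos
    proof (rule nn_integral_mono_AE[OF eventually_mono])
      fix \<omega> assume *: "\<forall>n\<ge>1. X (Inl n) \<omega> > 0 \<and> X (Inr n) \<omega> > 0"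
      show "(\<integral>\<^sup>+w. ennreal (partial n m (sample \<omega>)) \<partial>gamma_law (c + a (n + m))) \<le>
        (\<integral>\<^sup>+w. ennreal (partial n m (sample \<omega>) + weight n m (sample \<omega>) * w) \<partial>gamma_law (c + a (n + m)))"
        using weight_pos[OF * n, of m]
        by (intro nn_integral_mono_AE eventually_mono[OF AE_gamma_law_pos])
          (simp add: ennreal_leI)
    qed
    also have "\<dots> = ennreal (c + a n)"
      using a_pos[OF n] c_pos by (subst closed_partial_sum_law[OF _ n]) (simp_all add: gamma_law_mean del: ennreal_plus)
    finally show ?thesis .
  qed
  have "(\<integral>\<^sup>+\<omega>. (\<Sum>j. ennreal (?t j \<omega>)) \<partial>M) = (\<Sum>j. \<integral>\<^sup>+\<omega>. ennreal (?t j \<omega>) \<partial>M)"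
    by (rule nn_integral_suminf) measurable
  also have "\<dots> \<le> ennreal (c + a n)"
    using bound by (intro suminf_le_const) auto
  finally have "(\<integral>\<^sup>+\<omega>. (\<Sum>j. ennreal (?t j \<omega>)) \<partial>M) \<noteq> \<infinity>"
    by (auto simp: top_unique)
  then have "AE \<omega> in M. (\<Sum>j. ennreal (?t j \<omega>)) \<noteq> \<infinity>"
    by (intro nn_integral_PInf_AE) measurable
  with t_nonneg show ?thesis
    by eventually_elim (auto intro!: summable_suminf_not_top)
qed

lemma AE_tail_unfold:
  assumes "n \<ge> 1"
  shows "AE \<omega> in M. tail n (sample \<omega>) = X (Inl n) \<omega> + X (Inr n) \<omega> * tail (Suc n) (sample \<omega>)"
  using AE_summable_tail[of "Suc n"] by (rule eventually_mono) (simp, rule tail_unfold)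

text \<open>
  On the product of the sample space with the law of \<open>w\<close>, the partial sum and the closed partial sum
  differ by \<open>weight n m * w\<close>, whose mean tends to 0; the closed partial sum has law
  gamma(c + a n).
\<close>

lemma char_partial_tendsto:
  assumes n: "n \<ge> 1"
  shows "(\<lambda>m. CLINT \<omega>|M. iexp (t * partial n m (sample \<omega>))) \<longlonglongrightarrow> char (gamma_law (c + a n)) t"
proof -
  define e where "e m = \<bar>t\<bar> * ((\<Prod>l=n..<n+m. a l / (a (Suc l) + c)) * (a (n + m) + c))" for m
  have "e \<longlonglongrightarrow> \<bar>t\<bar> * 0"
    unfolding e_def using n a_pos a_le c_pos
    by (intro tendsto_mult tendsto_const gamma_beta_product_tendsto_0[where K="a 1 + \<alpha>"]) auto
  then have e_lim: "e \<longlonglongrightarrow> 0" by (simp only: mult_zero_right)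
  have "norm ((CLINT \<omega>|M. iexp (t * partial n m (sample \<omega>))) - char (gamma_law (c + a n)) t) \<le> e m"
    for m
  proof -
    let ?W = "gamma_law (c + a (n + m))"
    have pos: "c + a (n + m) > 0" using a_pos[of "n + m"] c_pos n by simp
    interpret W: prob_space ?W
      using pos by (rule prob_space_gamma_law)
    interpret MW: pair_prob_space M ?W ..
    define s where "s p = partial n m (sample (fst p)) + weight n m (sample (fst p)) * snd p" for p
    have [measurable]: "(\<lambda>\<omega>. partial n m (sample \<omega>)) \<in> borel_measurable M"
      "(\<lambda>\<omega>. weight n m (sample \<omega>)) \<in> borel_measurable M"
      using n by (intro sample_measurable; simp)+
    have s [measurable]: "s \<in> borel_measurable (M \<Otimes>\<^sub>M ?W)"
      unfolding s_def by measurable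
    have distr_s: "distr (M \<Otimes>\<^sub>M ?W) borel s = gamma_law (c + a n)"
    proof (rule measure_eqI)
      fix A assume "A \<in> sets (distr (M \<Otimes>\<^sub>M ?W) borel s)"
      then have [measurable]: "A \<in> sets borel" by simp
      have "emeasure (distr (M \<Otimes>\<^sub>M ?W) borel s) A = (\<integral>\<^sup>+p. indicator A (s p) \<partial>(M \<Otimes>\<^sub>M ?W))"
        by (subst nn_integral_indicator[symmetric], simp, subst nn_integral_distr) simp_all
      also have "\<dots> = (\<integral>\<^sup>+\<omega>. \<integral>\<^sup>+w. indicator A (partial n m (sample \<omega>) + weight n m (sample \<omega>) * w) \<partial>?W \<partial>M)"
        by (subst W.nn_integral_fst[symmetric]) (simp_all add: s_def)
      also have "\<dots> = emeasure (gamma_law (c + a n)) A"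
        using n by (subst closed_partial_sum_law) simp_all
      finally show "emeasure (distr (M \<Otimes>\<^sub>M ?W) borel s) A = emeasure (gamma_law (c + a n)) A" .
    qed simp
    have char_eq: "char (gamma_law (c + a n)) t = (CLINT p|M \<Otimes>\<^sub>M ?W. iexp (t * s p))"
      unfolding char_def distr_s[symmetric] by (rule integral_distr) measurable
    have "(CLINT \<omega>|M. iexp (t * partial n m (sample \<omega>))) =
        (CLINT \<omega>|distr (M \<Otimes>\<^sub>M ?W) M fst. iexp (t * partial n m (sample \<omega>)))"
      by (simp add: W.distr_pair_fst)
    also have "\<dots> = (CLINT p|M \<Otimes>\<^sub>M ?W. iexp (t * partial n m (sample (fst p))))"
      by (rule integral_distr) measurable
    finally have "(CLINT \<omega>|M. iexp (t * partial n m (sample \<omega>))) - char (gamma_law (c + a n)) t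
      = (CLINT p|M \<Otimes>\<^sub>M ?W. iexp (t * partial n m (sample (fst p))) - iexp (t * s p))"
      unfolding char_eq
      by (subst Bochner_Integration.integral_diff)
        (auto intro!: MW.integrable_const_bound[where B=1])
    then have "ennreal (norm ((CLINT \<omega>|M. iexp (t * partial n m (sample \<omega>))) - char (gamma_law (c + a n)) t))
      \<le> (\<integral>\<^sup>+p. ennreal (norm (iexp (t * partial n m (sample (fst p))) - iexp (t * s p))) \<partial>(M \<Otimes>\<^sub>M ?W))"
      by (simp only:) (intro integral_norm_bound_ennreal Bochner_Integration.integrable_diff
          MW.integrable_const_bound[where B=1], auto)
    also have "\<dots> \<le> (\<integral>\<^sup>+p. ennreal (\<bar>t\<bar> * \<bar>weight n m (sample (fst p)) * snd p\<bar>) \<partial>(M \<Otimes>\<^sub>M ?W))"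
    proof (intro nn_integral_mono ennreal_leI)
      fix p
      have "norm (iexp (t * partial n m (sample (fst p))) - iexp (t * s p))
        \<le> \<bar>t * partial n m (sample (fst p)) - t * s p\<bar>"
        by (rule norm_iexp_diff_le)
      also have "\<dots> = \<bar>t\<bar> * \<bar>weight n m (sample (fst p)) * snd p\<bar>"
        by (simp add: s_def algebra_simps flip: abs_mult)
      finally show "norm (iexp (t * partial n m (sample (fst p))) - iexp (t * s p))
        \<le> \<bar>t\<bar> * \<bar>weight n m (sample (fst p)) * snd p\<bar>" .
    qed
    also have "\<dots> = (\<integral>\<^sup>+\<omega>. \<integral>\<^sup>+w. ennreal (\<bar>t\<bar> * \<bar>weight n m (sample \<omega>) * w\<bar>) \<partial>?W \<partial>M)"
      by (subst W.nn_integral_fst[symmetric]) simp_all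
    also have "\<dots> = (\<integral>\<^sup>+\<omega>. ennreal \<bar>t\<bar> * (ennreal (weight n m (sample \<omega>)) * ennreal (c + a (n + m))) \<partial>M)"
      using AE_pos
    proof (rule nn_integral_cong_AE[OF eventually_mono])
      fix \<omega> assume *: "\<forall>n\<ge>1. X (Inl n) \<omega> > 0 \<and> X (Inr n) \<omega> > 0"
      have "(\<integral>\<^sup>+w. ennreal (\<bar>t\<bar> * \<bar>weight n m (sample \<omega>) * w\<bar>) \<partial>?W) =
        (\<integral>\<^sup>+w. ennreal \<bar>t\<bar> * (ennreal (weight n m (sample \<omega>)) * ennreal w) \<partial>?W)"
        using weight_pos[OF * n, of m]
        by (intro nn_integral_cong_AE eventually_mono[OF AE_gamma_law_pos])
          (simp add: abs_mult ennreal_mult)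
      then show "(\<integral>\<^sup>+w. ennreal (\<bar>t\<bar> * \<bar>weight n m (sample \<omega>) * w\<bar>) \<partial>?W) =
        ennreal \<bar>t\<bar> * (ennreal (weight n m (sample \<omega>)) * ennreal (c + a (n + m)))"
        using pos by (simp add: nn_integral_cmult gamma_law_mean del: ennreal_plus)
    qed
    also have "\<dots> = ennreal \<bar>t\<bar> * (ennreal (\<Prod>l=n..<n+m. a l / (a (Suc l) + c)) * ennreal (c + a (n + m)))"
      by (simp add: nn_integral_cmult nn_integral_multc weight_expectation[OF n] del: ennreal_plus)
    also have "\<dots> = ennreal (e m)"
      using pos by (simp add: e_def ennreal_mult' ennreal_mult'' add.commute del: ennreal_plus)
    finally have le: "ennreal (norm ((CLINT \<omega>|M. iexp (t * partial n m (sample \<omega>))) -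
      char (gamma_law (c + a n)) t)) \<le> ennreal (e m)" .
    have "(\<Prod>l=n..<n+m. a l / (a (Suc l) + c)) \<ge> 0"
    proof (rule prod_nonneg)
      fix l assume "l \<in> {n..<n + m}"
      then show "0 \<le> a l / (a (Suc l) + c)" using a_pos[of l] a_pos[of "Suc l"] c_pos n by simp
    qed
    then have "e m \<ge> 0" using pos by (simp add: e_def)
    with le show ?thesis by simp
  qed
  then have "(\<lambda>m. (CLINT \<omega>|M. iexp (t * partial n m (sample \<omega>))) -
      char (gamma_law (c + a n)) t) \<longlonglongrightarrow> 0"
    by (intro Lim_null_comparison[OF always_eventually e_lim] allI)
  then show ?thesis by (rule LIM_zero_cancel)
qed

lemma tail_law:
  assumes n: "n \<ge> 1"
  shows "distr M borel (\<lambda>\<omega>. tail n (sample \<omega>)) = gamma_law (c + a n)"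
proof (rule Levy_uniqueness)
  have tm [measurable]: "(\<lambda>\<omega>. tail n (sample \<omega>)) \<in> borel_measurable M"
    using n by (rule sample_measurable)
  have pm [measurable]: "(\<lambda>\<omega>. partial n m (sample \<omega>)) \<in> borel_measurable M" for m
    using n by (rule sample_measurable)
  show "real_distribution (distr M borel (\<lambda>\<omega>. tail n (sample \<omega>)))"
    by (rule real_distribution_distr) (rule tm)
  have "c + a n > 0" using c_pos a_pos[OF n] by simp
  then show "real_distribution (gamma_law (c + a n))"
    by (simp add: real_distribution_def real_distribution_axioms_def prob_space_gamma_law)
  show "char (distr M borel (\<lambda>\<omega>. tail n (sample \<omega>))) = char (gamma_law (c + a n))"
  proof
    fix t
    have "(\<lambda>m. CLINT \<omega>|M. iexp (t * partial n m (sample \<omega>))) \<longlonglongrightarrow> (CLINT \<omega>|M. iexp (t * tail n (sample \<omega>)))"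
    proof (rule integral_dominated_convergence[where w="\<lambda>_. 1"])
      show "AE \<omega> in M. (\<lambda>m. iexp (t * partial n m (sample \<omega>))) \<longlonglongrightarrow> iexp (t * tail n (sample \<omega>))"
        using AE_summable_tail[OF n]
      proof (rule eventually_mono)
        fix \<omega> assume "summable (\<lambda>j. X (Inl (n + j)) \<omega> * weight n j (sample \<omega>))"
        then have "(\<lambda>m. partial n m (sample \<omega>)) \<longlonglongrightarrow> tail n (sample \<omega>)"
          unfolding partial_def tail_def by (rule summable_LIMSEQ)
        then show "(\<lambda>m. iexp (t * partial n m (sample \<omega>))) \<longlonglongrightarrow> iexp (t * tail n (sample \<omega>))"
          by (intro tendsto_intros)
      qed
    qed auto
    also have "(CLINT \<omega>|M. iexp (t * tail n (sample \<omega>))) = char (distr M borel (\<lambda>\<omega>. tail n (sample \<omega>))) t"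
      unfolding char_def by (rule integral_distr[symmetric]) measurable
    finally show "char (distr M borel (\<lambda>\<omega>. tail n (sample \<omega>))) t = char (gamma_law (c + a n)) t"
      using char_partial_tendsto[OF n] by (rule LIMSEQ_unique)
  qed
qed

section \<open>Independence of the sticks\<close>

text \<open>
  The tail \<open>R n\<close> and the sticks \<open>Y n, \<dots>, Y (n + m - 1)\<close> are independent, with laws gamma(c + a n) and
  beta(c, a i). The arbitrary function \<open>f\<close> of \<open>R n\<close> is what makes the induction work: in terms of
  \<open>G n\<close>, \<open>U n\<close> and \<open>R (n + 1)\<close>, the factor \<open>f (R n)\<close> and the indicator of \<open>Y n \<in> B n\<close> together are,
  for fixed \<open>G n\<close> and \<open>U n\<close>, again a function of \<open>R (n + 1)\<close>.
\<close>

lemma tail_sticks_joint_law: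
  fixes f :: "real \<Rightarrow> ennreal" and B :: "nat \<Rightarrow> real set"
  assumes "f \<in> borel_measurable borel" and B: "\<And>i. B i \<in> sets borel" and "n \<ge> 1"
  shows "(\<integral>\<^sup>+\<omega>. f (tail n (sample \<omega>)) * (\<Prod>i=n..<n+m. indicator (B i) (stick i (sample \<omega>))) \<partial>M) =
    (\<integral>\<^sup>+x. f x \<partial>gamma_law (c + a n)) * (\<Prod>i=n..<n+m. emeasure (beta_law c (a i)) (B i))"
  using assms(1,3)
proof (induction m arbitrary: n f)
  case 0
  then have [measurable]: "f \<in> borel_measurable borel" "(\<lambda>\<omega>. tail n (sample \<omega>)) \<in> borel_measurable M"
    by (auto intro: sample_measurable)
  have "(\<integral>\<^sup>+\<omega>. f (tail n (sample \<omega>)) \<partial>M) = (\<integral>\<^sup>+x. f x \<partial>distr M borel (\<lambda>\<omega>. tail n (sample \<omega>)))"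
    by (subst nn_integral_distr) auto
  then show ?case
    using 0 by (simp add: tail_law)
next
  case (Suc m)
  have [measurable]: "f \<in> borel_measurable borel" and n: "n \<ge> 1" by fact+
  note B [measurable]
  have an: "a n > 0" "c + a (Suc n) = a n + (c + \<alpha>)" using a_pos[of n] a_Suc[of n] n by auto
  interpret R: prob_space "gamma_law (c + a (Suc n))"
    using a_pos[of "Suc n"] c_pos by (intro prob_space_gamma_law) simp
  interpret T: prob_space "beta_law (a n) (c + \<alpha>)"
    using an c_pos alpha_nonneg by (intro prob_space_beta_law) simp_all
  define p where "p z = (\<Prod>i=Suc n..<Suc n+m. indicator (B i) (stick i z) :: ennreal)" for z
  define C where "C = (\<Prod>i=Suc n..<Suc n+m. emeasure (beta_law c (a i)) (B i))"
  define h where "h g u r = f (g + u * r) * indicator (B n) (g / (g + u * r))" for g u r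
  have h [measurable]: "(\<lambda>(g, u, r). h g u r) \<in> borel_measurable (borel \<Otimes>\<^sub>M borel \<Otimes>\<^sub>M borel)"
    unfolding h_def by measurable
  have [measurable]: "(\<lambda>(g, u, y). case y of (r, q) \<Rightarrow> h g u r * q)
      \<in> borel_measurable (borel \<Otimes>\<^sub>M borel \<Otimes>\<^sub>M borel \<Otimes>\<^sub>M borel)"
    unfolding h_def by measurable
  have p_measurable: "p \<in> borel_measurable (PiM (indices_from (Suc n)) (\<lambda>_. borel))"
    unfolding p_def
    by (intro borel_measurable_prod_ennreal measurable_compose[OF stick_measurable borel_measurable_indicator] B)
      simp
  have p_restrict: "p (restrict z (indices_from (Suc n))) = p z" for z
    by (simp add: p_def stick_restrict)
  have "(\<integral>\<^sup>+\<omega>. f (tail n (sample \<omega>)) * (\<Prod>i=n..<n+Suc m. indicator (B i) (stick i (sample \<omega>))) \<partial>M) =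
    (\<integral>\<^sup>+\<omega>. (\<lambda>g u (r, q). h g u r * q) (X (Inl n) \<omega>) (X (Inr n) \<omega>)
      (tail (Suc n) (sample \<omega>), p (sample \<omega>)) \<partial>M)"
    using AE_tail_unfold[OF n]
    by (rule nn_integral_cong_AE[OF eventually_mono])
      (simp add: prod.atLeast_Suc_lessThan p_def h_def stick_def mult_ac)
  also have "\<dots> = (\<integral>\<^sup>+g. \<integral>\<^sup>+u. \<integral>\<^sup>+\<omega>. (\<lambda>g u (r, q). h g u r * q) g u
      (tail (Suc n) (sample \<omega>), p (sample \<omega>)) \<partial>M \<partial>beta_law (a n) (c + \<alpha>) \<partial>gamma_law c)"
    using n p_measurable
    by (intro nn_integral_first_pair[where N="borel \<Otimes>\<^sub>M borel" and F="\<lambda>z. (tail (Suc n) z, p z)"])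
      (simp_all add: tail_restrict p_restrict)
  also have "\<dots> = (\<integral>\<^sup>+g. \<integral>\<^sup>+u. (\<integral>\<^sup>+r. h g u r \<partial>gamma_law (c + a (Suc n))) * C
      \<partial>beta_law (a n) (c + \<alpha>) \<partial>gamma_law c)"
    unfolding prod.case p_def C_def by (intro nn_integral_cong Suc.IH) measurable
  also have "\<dots> = (\<integral>\<^sup>+g. \<integral>\<^sup>+u. \<integral>\<^sup>+r. h g u r \<partial>gamma_law (c + a (Suc n))
      \<partial>beta_law (a n) (c + \<alpha>) \<partial>gamma_law c) * C"
  proof -
    have "(\<lambda>g. \<integral>\<^sup>+u. \<integral>\<^sup>+r. h g u r \<partial>gamma_law (c + a (Suc n)) \<partial>beta_law (a n) (c + \<alpha>))
        \<in> borel_measurable (gamma_law c)"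
      unfolding h_def by measurable
    then show ?thesis by (simp add: nn_integral_multc)
  qed
  also have "(\<integral>\<^sup>+g. \<integral>\<^sup>+u. \<integral>\<^sup>+r. h g u r \<partial>gamma_law (c + a (Suc n))
      \<partial>beta_law (a n) (c + \<alpha>) \<partial>gamma_law c) =
      (\<integral>\<^sup>+x. \<integral>\<^sup>+y. f x * indicator (B n) y \<partial>beta_law c (a n) \<partial>gamma_law (c + a n))"
    unfolding an h_def using an c_pos alpha_nonneg
    by (intro gamma_beta_renewal[where h="\<lambda>x y. f x * indicator (B n) y"]) simp_all
  also have "\<dots> = (\<integral>\<^sup>+x. f x \<partial>gamma_law (c + a n)) * emeasure (beta_law c (a n)) (B n)"
    by (simp add: nn_integral_cmult nn_integral_multc)
  finally show ?case
    by (simp add: C_def prod.atLeast_Suc_lessThan mult_ac)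
qed

lemma sticks_joint_law:
  assumes B: "\<And>i. B i \<in> sets borel"
  shows "emeasure M {\<omega> \<in> space M. \<forall>i\<in>{1..<1+m}. stick i (sample \<omega>) \<in> B i} =
    (\<Prod>i=1..<1+m. emeasure (beta_law c (a i)) (B i))"
proof -
  interpret R: prob_space "gamma_law (c + a 1)"
    using a_pos[of 1] c_pos by (intro prob_space_gamma_law) simp
  note B [measurable]
  have prod_indicator: "(\<Prod>i\<in>I. indicator (B i) (y i) :: ennreal) = (if \<forall>i\<in>I. y i \<in> B i then 1 else 0)"
    if "finite I" for I :: "nat set" and y
    using that by (induction I) (auto simp: indicator_def)
  have [measurable]: "(\<lambda>\<omega>. stick i (sample \<omega>)) \<in> borel_measurable M" if "i \<in> {1..<1+m}" for i
    using that by (intro sample_measurable) auto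
  have "emeasure M {\<omega> \<in> space M. \<forall>i\<in>{1..<1+m}. stick i (sample \<omega>) \<in> B i}
    = (\<integral>\<^sup>+\<omega>. indicator {\<omega> \<in> space M. \<forall>i\<in>{1..<1+m}. stick i (sample \<omega>) \<in> B i} \<omega> \<partial>M)"
    by (rule nn_integral_indicator[symmetric]) measurable
  also have "\<dots> = (\<integral>\<^sup>+\<omega>. 1 * (\<Prod>i=1..<1+m. indicator (B i) (stick i (sample \<omega>))) \<partial>M)"
    by (rule nn_integral_cong) (simp only: prod_indicator finite_atLeastLessThan, simp add: indicator_def)
  also have "\<dots> = (\<Prod>i=1..<1+m. emeasure (beta_law c (a i)) (B i))"
    using R.emeasure_space_1 by (subst tail_sticks_joint_law[OF _ B]) auto
  finally show ?thesis .
qed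

lemma stick_law:
  assumes "n \<ge> 1"
  shows "distr M borel (\<lambda>\<omega>. stick n (sample \<omega>)) = beta_law c (a n)"
proof (rule measure_eqI)
  have [measurable]: "(\<lambda>\<omega>. stick n (sample \<omega>)) \<in> borel_measurable M"
    using assms by (rule sample_measurable)
  fix A assume "A \<in> sets (distr M borel (\<lambda>\<omega>. stick n (sample \<omega>)))"
  then have [measurable]: "A \<in> sets borel" by simp
  define B where "B i = (if i = n then A else UNIV)" for i
  have "emeasure (distr M borel (\<lambda>\<omega>. stick n (sample \<omega>))) A
    = emeasure M {\<omega> \<in> space M. \<forall>i\<in>{1..<1+n}. stick i (sample \<omega>) \<in> B i}"
    using assms by (subst emeasure_distr) (auto simp: B_def intro!: arg_cong[where f="emeasure M"])
  also have "\<dots> = (\<Prod>i=1..<1+n. emeasure (beta_law c (a i)) (B i))"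
    by (rule sticks_joint_law) (simp add: B_def)
  also have "\<dots> = (\<Prod>i=1..<1+n. if i = n then emeasure (beta_law c (a n)) A else 1)"
  proof (rule prod.cong)
    fix i assume "i \<in> {1..<1+n}"
    then interpret B: prob_space "beta_law c (a i)"
      using c_pos a_pos by (intro prob_space_beta_law) auto
    show "emeasure (beta_law c (a i)) (B i) = (if i = n then emeasure (beta_law c (a n)) A else 1)"
      using B.emeasure_space_1 by (simp add: B_def)
  qed simp
  also have "\<dots> = emeasure (beta_law c (a n)) A"
    using assms by (subst prod.delta) auto
  finally show "emeasure (distr M borel (\<lambda>\<omega>. stick n (sample \<omega>))) A = emeasure (beta_law c (a n)) A" .
qed simp

lemma indep_sticks: "indep_vars (\<lambda>_. borel) (\<lambda>n \<omega>. stick n (sample \<omega>)) {1..}"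
  unfolding indep_vars_def2
proof (intro conjI ballI indep_setsI)
  let ?Y = "\<lambda>n \<omega>. stick n (sample \<omega>)"
  have Y [measurable]: "?Y n \<in> borel_measurable M" if "n \<ge> 1" for n
    using that by (rule sample_measurable)
  fix n :: nat assume n: "n \<in> {1..}"
  then show "?Y n \<in> borel_measurable M" by simp
  then show "{?Y n -` A \<inter> space M |A. A \<in> sets borel} \<subseteq> events" by auto
next
  let ?Y = "\<lambda>n \<omega>. stick n (sample \<omega>)"
  have Y [measurable]: "?Y n \<in> borel_measurable M" if "n \<ge> 1" for n
    using that by (rule sample_measurable)
  fix E :: "nat \<Rightarrow> 'w set" and J :: "nat set"
  assume J: "J \<noteq> {}" "J \<subseteq> {1..}" "finite J"
    and "\<forall>j\<in>J. E j \<in> {?Y j -` A \<inter> space M |A. A \<in> sets borel}"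
  then obtain A where A: "\<And>j. j \<in> J \<Longrightarrow> A j \<in> sets borel" "\<And>j. j \<in> J \<Longrightarrow> E j = ?Y j -` A j \<inter> space M"
    by (auto simp: Bex_def) metis
  \<comment> \<open>Pad the index set to an initial segment; the added sticks are unconstrained.\<close>
  define B where "B j = (if j \<in> J then A j else UNIV)" for j
  define m where "m = Max J"
  have Jm: "J \<subseteq> {1..<1+m}"
    using J by (auto simp: m_def less_Suc_eq_le)
  have "emeasure M (\<Inter>j\<in>J. E j) = emeasure M {\<omega> \<in> space M. \<forall>i\<in>{1..<1+m}. ?Y i \<omega> \<in> B i}"
    using J(1) Jm by (intro arg_cong[where f="emeasure M"]) (auto simp: A B_def)
  also have "\<dots> = (\<Prod>i=1..<1+m. emeasure (beta_law c (a i)) (B i))"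
    by (rule sticks_joint_law) (simp add: B_def A)
  also have "\<dots> = (\<Prod>i\<in>J. emeasure M (E i))"
  proof (rule prod.mono_neutral_cong_right)
    show "\<forall>i\<in>{1..<1+m} - J. emeasure (beta_law c (a i)) (B i) = 1"
    proof
      fix i assume i: "i \<in> {1..<1+m} - J"
      then interpret B: prob_space "beta_law c (a i)"
        using c_pos a_pos by (intro prob_space_beta_law) auto
      show "emeasure (beta_law c (a i)) (B i) = 1"
        using i B.emeasure_space_1 by (simp add: B_def)
    qed
    fix i assume i: "i \<in> J"
    then have "i \<ge> 1" using J by auto
    with i show "emeasure (beta_law c (a i)) (B i) = emeasure M (E i)"
      by (simp add: stick_law[symmetric] emeasure_distr A B_def)
  qed (use Jm in auto)
  finally show "prob (\<Inter>j\<in>J. E j) = (\<Prod>j\<in>J. prob (E j))"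
    by (simp add: emeasure_eq_measure prod_ennreal prod_nonneg)
qed

section \<open>The stick-breaking representation\<close>

lemma AE_stick_breaking:
  "AE \<omega> in M. \<forall>n\<ge>1. X (Inl n) \<omega> * (\<Prod>l=1..<n. X (Inr l) \<omega>) / tail 1 (sample \<omega>) =
    (\<Prod>l=1..<n. 1 - stick l (sample \<omega>)) * stick n (sample \<omega>)"
proof -
  have "AE \<omega> in M. \<forall>n\<ge>1. summable (\<lambda>j. X (Inl (n + j)) \<omega> * weight n j (sample \<omega>))"
    using AE_summable_tail by (simp add: AE_all_countable AE_impI)
  with AE_pos show ?thesis
  proof eventually_elim
    case (elim \<omega>)
    have unfold: "tail n (sample \<omega>) = X (Inl n) \<omega> + X (Inr n) \<omega> * tail (Suc n) (sample \<omega>)" if "n \<ge> 1" for n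
      using elim(2)[rule_format, of "Suc n"] by (intro tail_unfold) simp
    have pos: "tail n (sample \<omega>) > 0" if "n \<ge> 1" for n
      unfolding tail_def
    proof (rule suminf_pos)
      fix j
      have "X (Inl (n + j)) \<omega> > 0" using elim(1) that by simp
      then show "0 < X (Inl (n + j)) \<omega> * weight n j (sample \<omega>)"
        using weight_pos[OF elim(1) that, of j] by simp
    qed (use elim(2) that in simp)
    have prod: "(\<Prod>l=1..<n. 1 - stick l (sample \<omega>)) =
      (\<Prod>l=1..<n. X (Inr l) \<omega>) * tail n (sample \<omega>) / tail 1 (sample \<omega>)" if "n \<ge> 1" for n
      using that
    proof (induction n rule: nat_induct_at_least)
      case base
      show ?case using pos[of 1] by simp
    next
      case (Suc n)
      have "1 - stick n (sample \<omega>) = X (Inr n) \<omega> * tail (Suc n) (sample \<omega>) / tail n (sample \<omega>)"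
        using pos[OF Suc.hyps] unfold[OF Suc.hyps] by (simp add: stick_def field_simps)
      then show ?case
        using pos[OF Suc.hyps] Suc by (simp add: prod.atLeastLessThan_Suc)
    qed
    show ?case
    proof (intro allI impI)
      fix n :: nat assume n: "n \<ge> 1"
      show "X (Inl n) \<omega> * (\<Prod>l=1..<n. X (Inr l) \<omega>) / tail 1 (sample \<omega>) =
        (\<Prod>l=1..<n. 1 - stick l (sample \<omega>)) * stick n (sample \<omega>)"
        unfolding prod[OF n] using pos[OF n] by (simp add: stick_def)
    qed
  qed
qed

end

theorem theorem2p4:
  fixes M :: "'w measure"
    and \<alpha> c :: real
    and a :: "nat \<Rightarrow> real"
    and G U P V :: "nat \<Rightarrow> 'w \<Rightarrow> real"
  assumes "prob_space M"
    and "\<alpha> \<ge> 0" and "a 1 > 0" and "c > 0"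
    and "\<And>n. n \<ge> 1 \<Longrightarrow> a n = a 1 + (real n - 1) * \<alpha>"
    and "\<And>n. n \<ge> 1 \<Longrightarrow> distributed M lborel (G n) (gamma_density c)"
    and "\<And>n. n \<ge> 1 \<Longrightarrow> distributed M lborel (U n) (beta_density (a n) (c + \<alpha>))"
    and "prob_space.indep_vars M (\<lambda>_. borel) (case_sum G U) ({1..} <+> {1..})"
    and "\<And>j \<omega>. j \<ge> 1 \<Longrightarrow> P j \<omega> = (\<Prod>l=1..<j. U l \<omega>)"
    and "\<And>n \<omega>. n \<ge> 1 \<Longrightarrow> V n \<omega> = G n \<omega> * P n \<omega> / (\<Sum>j. G (Suc j) \<omega> * P (Suc j) \<omega>)"
  shows "(AE \<omega> in M. summable (\<lambda>j. G (Suc j) \<omega> * P (Suc j) \<omega>)) \<and>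
    (\<exists>Y :: nat \<Rightarrow> 'w \<Rightarrow> real.
       prob_space.indep_vars M (\<lambda>_. borel) Y {1..} \<and>
       (\<forall>n\<ge>1. distributed M lborel (Y n) (beta_density c (a n))) \<and>
       (AE \<omega> in M. \<forall>n\<ge>1. V n \<omega> = (\<Prod>l=1..<n. 1 - Y l \<omega>) * Y n \<omega>))"
proof -
  interpret gamma_beta_sequence M \<alpha> c a "case_sum G U"
  proof (intro gamma_beta_sequence.intro gamma_beta_sequence_axioms.intro)
    fix n :: nat assume n: "n \<ge> 1"
    show "a n = a 1 + (real n - 1) * \<alpha>" using assms(5) n .
    have "distr M lborel (G n) = gamma_law c" "distr M lborel (U n) = beta_law (a n) (c + \<alpha>)"
      using assms(6,7)[OF n] by (simp_all add: distributed_def gamma_law_def beta_law_def)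
    moreover have "distr M lborel f = distr M borel f" for f :: "'w \<Rightarrow> real"
      by (rule distr_cong) auto
    ultimately show "distr M borel (case_sum G U (Inl n)) = gamma_law c"
      "distr M borel (case_sum G U (Inr n)) = beta_law (a n) (c + \<alpha>)"
      by simp_all
  next
    show "prob_space M" by fact
    show "\<alpha> \<ge> 0" by fact
    show "a 1 > 0" by fact
    show "c > 0" by fact
    show "prob_space.indep_vars M (\<lambda>_. borel) (case_sum G U) (indices_from 1)"
      using assms(8) unfolding indices_from_def .
  qed
  have term_eq: "G (Suc j) \<omega> * P (Suc j) \<omega> =
    case_sum G U (Inl (1 + j)) \<omega> * weight 1 j (sample \<omega>)" for j \<omega>
    by (simp add: assms(9) weight_def)
  have V_eq: "V n \<omega> = case_sum G U (Inl n) \<omega> * (\<Prod>l=1..<n. case_sum G U (Inr l) \<omega>) / tail 1 (sample \<omega>)"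
    if "n \<ge> 1" for n \<omega>
    using assms(9,10)[OF that] by (simp only: term_eq tail_def sum.case)
  define Y where "Y n \<omega> = stick n (sample \<omega>)" for n \<omega>
  show ?thesis
  proof (intro conjI exI[of _ Y] allI impI)
    show "AE \<omega> in M. summable (\<lambda>j. G (Suc j) \<omega> * P (Suc j) \<omega>)"
      using AE_summable_tail[of 1] by (simp only: term_eq)
    show "indep_vars (\<lambda>_. borel) Y {1..}"
      using indep_sticks unfolding Y_def .
    show "AE \<omega> in M. \<forall>n\<ge>1. V n \<omega> = (\<Prod>l=1..<n. 1 - Y l \<omega>) * Y n \<omega>"
      using AE_stick_breaking by (auto simp: V_eq Y_def)
    fix n :: nat assume n: "n \<ge> 1"
    have "distr M lborel (Y n) = distr M borel (Y n)"
      by (rule distr_cong) auto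
    also have "\<dots> = beta_law c (a n)"
      unfolding Y_def using n by (rule stick_law)
    finally show "distributed M lborel (Y n) (beta_density c (a n))"
      using sample_measurable(4)[OF n] unfolding Y_def[symmetric]
      by (simp add: distributed_def beta_law_def)
  qed
qed

end
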